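(* Let $k$ be a field and let $J=J(\Delta)\subseteq k[x_1,\ldots,x_n]$ be the cover ideal of a non-uniform paving matroid $\Delta$ of rank $c$ on $[n]$. Then $$\widehat\alpha(J)=\min\left\{\alpha(J),\ \frac nc\right\}.$$
   Context: A matroid on $[n]$ is identified with the simplicial complex whose facets are its bases. A matroid is paving if all its circuits have size at least its rank; it is uniform if its bases are all subsets of $[n]$ of size equal to its rank. The cover ideal is $J(\Delta)=\bigcap_F(x_i:i\in F)$, intersection over the bases $F$. For a squarefree monomial ideal $J\subseteq R$, $J^{(\ell)}=\bigcap_{\mathfrak p\in\operatorname{Ass}(R/J)}\mathfrak p^\ell$. For a nonzero homogeneous ideal $L$, $\alpha(L)$ is the smallest degree of a nonzero element of $L$; $\widehat\alpha(J)=\lim_{\ell\to\infty}\alpha(J^{(\ell)})/\ell$ is the Waldschmidt constant of $J$. *)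

theory Defs
  imports Complex_Main "HOL-Library.Poly_Mapping" "HOL-Algebra.Algebra"
    "HOL-Algebra.Algebraic_Closure_Type"
begin

section \<open>Matroids as simplicial complexes\<close>

definition matroid_on :: "'a set \<Rightarrow> 'a set set \<Rightarrow> bool" where
  "matroid_on E \<Delta> \<longleftrightarrow>
     finite E \<and> \<Delta> \<subseteq> Pow E \<and> {} \<in> \<Delta> \<and>
     (\<forall>A\<in>\<Delta>. \<forall>B. B \<subseteq> A \<longrightarrow> B \<in> \<Delta>) \<and>
     (\<forall>A\<in>\<Delta>. \<forall>B\<in>\<Delta>. card A < card B \<longrightarrow> (\<exists>x\<in>B - A. insert x A \<in> \<Delta>))"

definition bases :: "'a set set \<Rightarrow> 'a set set" where
  "bases \<Delta> = {F \<in> \<Delta>. \<forall>G\<in>\<Delta>. F \<subseteq> G \<longrightarrow> F = G}"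

definition circuits :: "'a set \<Rightarrow> 'a set set \<Rightarrow> 'a set set" where
  "circuits E \<Delta> = {C. C \<subseteq> E \<and> C \<notin> \<Delta> \<and> (\<forall>D. D \<subset> C \<longrightarrow> D \<in> \<Delta>)}"

text \<open>All bases of a matroid have the same cardinality, so the maximum below is the
  cardinality of any basis.\<close>

definition matroid_rank :: "'a set set \<Rightarrow> nat" where
  "matroid_rank \<Delta> = Max (card ` bases \<Delta>)"

definition paving :: "'a set \<Rightarrow> 'a set set \<Rightarrow> bool" where
  "paving E \<Delta> \<longleftrightarrow> (\<forall>C\<in>circuits E \<Delta>. card C \<ge> matroid_rank \<Delta>)"

definition uniform :: "'a set \<Rightarrow> 'a set set \<Rightarrow> bool" where
  "uniform E \<Delta> \<longleftrightarrow> bases \<Delta> = {F. F \<subseteq> E \<and> card F = matroid_rank \<Delta>}"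


section \<open>The polynomial ring and cover ideals\<close>

text \<open>Polynomials in the variables \<open>x\<^sub>0, x\<^sub>1, \<dots>\<close> are finitely supported functions from
  exponent vectors to coefficients, with the convolution product of
  \<^theory>\<open>HOL-Library.Poly_Mapping\<close>. The ring \<open>k[x\<^sub>1,\<dots>,x\<^sub>n]\<close> consists of those in which only
  variables with index in \<open>{1..n}\<close> occur.\<close>

type_synonym 'k mpoly = "(nat \<Rightarrow>\<^sub>0 nat) \<Rightarrow>\<^sub>0 'k"

definition poly_ring :: "nat \<Rightarrow> 'k::field mpoly ring" where
  "poly_ring n = ring_of_type_algebra
     \<lparr>carrier := {p. \<forall>m\<in>Poly_Mapping.keys p. Poly_Mapping.keys m \<subseteq> {1..n}}\<rparr>"

definition var :: "nat \<Rightarrow> 'k::field mpoly" where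
  "var i = Poly_Mapping.single (Poly_Mapping.single i 1) 1"

definition monom_degree :: "(nat \<Rightarrow>\<^sub>0 nat) \<Rightarrow> nat" where
  "monom_degree m = (\<Sum>i\<in>Poly_Mapping.keys m. Poly_Mapping.lookup m i)"

text \<open>Only meaningful for nonzero polynomials.\<close>

definition total_degree :: "'k::field mpoly \<Rightarrow> nat" where
  "total_degree p = Max (monom_degree ` Poly_Mapping.keys p)"

definition alpha :: "'k::field mpoly set \<Rightarrow> nat" where
  "alpha L = (LEAST d. \<exists>f\<in>L. f \<noteq> 0 \<and> total_degree f = d)"

definition cover_ideal :: "nat \<Rightarrow> nat set set \<Rightarrow> 'k::field mpoly set" where
  "cover_ideal n \<Delta> = (\<Inter>F\<in>bases \<Delta>. genideal (poly_ring n) (var ` F))"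


section \<open>Symbolic powers and the Waldschmidt constant\<close>

text \<open>The prime ideals of \<open>R\<close> that are annihilators of an element of the \<open>R\<close>-module \<open>R/J\<close>.\<close>

definition associated_primes :: "'a ring \<Rightarrow> 'a set \<Rightarrow> 'a set set" where
  "associated_primes R J =
     {P. primeideal P R \<and>
         (\<exists>x\<in>carrier (R Quot J).
            P = {r \<in> carrier R. (J +>\<^bsub>R\<^esub> r) \<otimes>\<^bsub>R Quot J\<^esub> x = \<zero>\<^bsub>R Quot J\<^esub>})}"

text \<open>Ideal powers are powers in the multiplicative monoid of ideals \<^const>\<open>ideals_set\<close>, whose
  unit is the whole ring. The intersection with the carrier only matters when there are no
  associated primes, that is, for \<open>J = R\<close>.\<close>

definition symbolic_power :: "'a ring \<Rightarrow> 'a set \<Rightarrow> nat \<Rightarrow> 'a set" where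
  "symbolic_power R J l =
     carrier R \<inter> (\<Inter>P\<in>associated_primes R J. P [^]\<^bsub>ideals_set R\<^esub> l)"

definition waldschmidt_seq :: "nat \<Rightarrow> 'k::field mpoly set \<Rightarrow> nat \<Rightarrow> real" where
  "waldschmidt_seq n J l = real (alpha (symbolic_power (poly_ring n) J l)) / real l"

definition waldschmidt :: "nat \<Rightarrow> 'k::field mpoly set \<Rightarrow> real" where
  "waldschmidt n J = lim (waldschmidt_seq n J)"

end

(*
  The associated primes of J are the ideals P_F generated by the variables of a basis F, so the
  l-th symbolic power is spanned by the monomials whose exponent vector w satisfies w(F) >= l for
  every basis F. The Waldschmidt constant is therefore the value of the linear program that
  minimizes the total weight subject to w(F) >= 1. A minimal hitting set of the bases and the
  constant vector 1/c give the upper bound. For the lower bound let A be the c - 1 lightest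
  elements, which are independent because the matroid is paving, and let B be the set of elements
  completing A to a basis. Then B meets every basis, so |B| >= alpha(J), and comparing the weights
  of A, B and the remaining elements with the lightest basis A + j gives the bound.
*)
theory Submission
  imports Defs
begin

section \<open>Ideals spanned by monomials\<close>

abbreviation keys where "keys \<equiv> Poly_Mapping.keys"
abbreviation lookup where "lookup \<equiv> Poly_Mapping.lookup"
abbreviation single where "single \<equiv> Poly_Mapping.single"

definition exps :: "nat \<Rightarrow> (nat \<Rightarrow>\<^sub>0 nat) set" where
  "exps n = {m. keys m \<subseteq> {1..n}}"

text \<open>The primes, the cover ideal and its symbolic powers all take this form, which reduces
  questions about them to sets of exponents. \<open>M\<close> need not be upward closed, so that a
  complement of an ideal can be described too.\<close>

definition mono_span :: "(nat \<Rightarrow>\<^sub>0 nat) set \<Rightarrow> 'k::field mpoly set" where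
  "mono_span M = {p. keys p \<subseteq> M}"

definition weight :: "nat set \<Rightarrow> (nat \<Rightarrow>\<^sub>0 nat) \<Rightarrow> nat" where
  "weight F m = (\<Sum>i\<in>F. lookup m i)"

text \<open>For \<open>F\<close> inside \<open>{1..n}\<close> these are the exponents of the
  monomials in the \<open>l\<close>-th power of the prime generated by the variables of
  \<open>F\<close>.\<close>

definition heavy :: "nat \<Rightarrow> nat set \<Rightarrow> nat \<Rightarrow> (nat \<Rightarrow>\<^sub>0 nat) set" where
  "heavy n F l = {m \<in> exps n. l \<le> weight F m}"

lemma keys_add_nat: "keys (a + b :: nat \<Rightarrow>\<^sub>0 nat) = keys a \<union> keys b"
  by (auto simp: in_keys_iff lookup_add)

lemma exps_add [simp]: "a + b \<in> exps n \<longleftrightarrow> a \<in> exps n \<and> b \<in> exps n"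
  by (auto simp: exps_def keys_add_nat)

lemma exps_zero [simp]: "0 \<in> exps n"
  by (simp add: exps_def)

lemma exps_single [simp]: "i \<in> {1..n} \<Longrightarrow> single i k \<in> exps n"
  by (simp add: exps_def)

lemma weight_add: "weight F (a + b) = weight F a + weight F b"
  by (simp add: weight_def lookup_add sum.distrib)

lemma weight_single: "finite F \<Longrightarrow> weight F (single i k) = (if i \<in> F then k else 0)"
  by (simp add: weight_def lookup_single when_def)

lemma mono_span_mono: "M \<subseteq> N \<Longrightarrow> mono_span M \<subseteq> mono_span N"
  by (auto simp: mono_span_def)

lemma zero_mono_span [simp]: "0 \<in> mono_span M"
  by (simp add: mono_span_def)

lemma mono_span_add: "p \<in> mono_span M \<Longrightarrow> q \<in> mono_span M \<Longrightarrow> p + q \<in> mono_span M"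
  using keys_add[of p q] by (auto simp: mono_span_def)

lemma mono_span_uminus: "p \<in> mono_span M \<Longrightarrow> - p \<in> mono_span M"
  by (simp add: mono_span_def)

lemma mono_span_mult:
  assumes "p \<in> mono_span M" "q \<in> mono_span N" "\<And>a b. a \<in> M \<Longrightarrow> b \<in> N \<Longrightarrow> a + b \<in> L"
  shows "p * q \<in> mono_span L"
  using keys_mult[of p q] assms by (fastforce simp: mono_span_def)

lemma single_mono_span [simp]: "c \<noteq> 0 \<Longrightarrow> single m c \<in> mono_span M \<longleftrightarrow> m \<in> M"
  by (simp add: mono_span_def)

section \<open>The polynomial ring and its monomial ideals\<close>

lemma poly_ring_simps [simp]:
  "carrier (poly_ring n) = mono_span (exps n)"
  "x \<oplus>\<^bsub>poly_ring n\<^esub> y = x + y" "x \<otimes>\<^bsub>poly_ring n\<^esub> y = x * y"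
  "\<zero>\<^bsub>poly_ring n\<^esub> = 0" "\<one>\<^bsub>poly_ring n\<^esub> = 1"
  by (auto simp: poly_ring_def ring_of_type_algebra_def mono_span_def exps_def)

lemma cring_poly_ring: "cring (poly_ring n :: 'k::field mpoly ring)"
proof (rule cringI)
  show "abelian_group (poly_ring n :: 'k mpoly ring)"
  proof (rule abelian_groupI)
    fix x :: "'k mpoly" assume "x \<in> carrier (poly_ring n)"
    then show "\<exists>y\<in>carrier (poly_ring n). y \<oplus>\<^bsub>poly_ring n\<^esub> x = \<zero>\<^bsub>poly_ring n\<^esub>"
      by (intro bexI[of _ "- x"]) (simp_all add: mono_span_uminus)
  qed (simp_all add: mono_span_add add_ac)
  show "comm_monoid (poly_ring n :: 'k mpoly ring)"
  proof (rule comm_monoidI)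
    fix x y :: "'k mpoly" assume "x \<in> carrier (poly_ring n)" "y \<in> carrier (poly_ring n)"
    then show "x \<otimes>\<^bsub>poly_ring n\<^esub> y \<in> carrier (poly_ring n)"
      using mono_span_mult[of x "exps n" y "exps n" "exps n"] by simp
  qed (simp_all add: mult_ac flip: single_one)
qed (simp add: distrib_right)

lemma ideal_mono_span:
  assumes "M \<subseteq> exps n" "\<And>a m. a \<in> exps n \<Longrightarrow> m \<in> M \<Longrightarrow> a + m \<in> M"
  shows "ideal (mono_span M) (poly_ring n :: 'k::field mpoly ring)"
proof -
  interpret cring "poly_ring n :: 'k mpoly ring" by (rule cring_poly_ring)
  show ?thesis
  proof (rule idealI[OF ring_axioms])
    show "subgroup (mono_span M) (add_monoid (poly_ring n :: 'k mpoly ring))"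
    proof (rule add.subgroupI)
      fix a :: "'k mpoly" assume a: "a \<in> mono_span M"
      then have "a \<in> carrier (poly_ring n)" using mono_span_mono[OF assms(1)] by auto
      moreover have "- a \<in> carrier (poly_ring n)"
        using mono_span_uminus[OF a] mono_span_mono[OF assms(1)] by auto
      ultimately have "\<ominus>\<^bsub>poly_ring n\<^esub> a = - a"
        by (intro minus_equality) auto
      then show "\<ominus>\<^bsub>poly_ring n\<^esub> a \<in> mono_span M"
        using mono_span_uminus[OF a] by simp
    next
      show "mono_span M \<noteq> ({} :: 'k mpoly set)"
        using zero_mono_span by blast
    qed (use mono_span_mono[OF assms(1)] mono_span_add in auto)
    fix a x :: "'k mpoly" assume "a \<in> mono_span M" "x \<in> carrier (poly_ring n)"
    then have "x * a \<in> mono_span M"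
      using mono_span_mult[of x "exps n" a M M] assms(2) by simp
    then show "x \<otimes>\<^bsub>poly_ring n\<^esub> a \<in> mono_span M" "a \<otimes>\<^bsub>poly_ring n\<^esub> x \<in> mono_span M"
      by (simp_all add: mult.commute)
  qed
qed

lemma mpoly_eq_sum: "p = (\<Sum>m\<in>keys p. single m (lookup p m))"
  by (rule poly_mapping_eqI)
    (auto simp: lookup_sum lookup_single when_def in_keys_iff)

text \<open>Constants belong to the ring, so an ideal containing the monomials with exponents in
  \<open>M\<close> also contains their scalar multiples and the finite sums of these.\<close>

lemma mono_span_subset:
  assumes "M \<subseteq> exps n" "\<And>m. m \<in> M \<Longrightarrow> single m 1 \<in> I"
    and "ideal I (poly_ring n :: 'k::field mpoly ring)"
  shows "mono_span M \<subseteq> I"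
proof
  interpret ideal I "poly_ring n" by (rule assms)
  fix p :: "'k mpoly" assume p: "p \<in> mono_span M"
  have mem: "single m c \<in> I" if "m \<in> M" for m c
  proof -
    have "single 0 c \<in> carrier (poly_ring n)"
      by (cases "c = 0") auto
    from I_l_closed[OF assms(2)[OF that] this] show ?thesis
      by (simp add: mult_single)
  qed
  have "keys p \<subseteq> M" using p by (simp add: mono_span_def)
  have "(\<Sum>m\<in>K. single m (lookup p m)) \<in> I" if "finite K" "K \<subseteq> keys p" for K
    using that
  proof (induction K rule: finite_induct)
    case empty
    then show ?case using additive_subgroup.zero_closed[OF is_additive_subgroup] by simp
  next
    case (insert m K)
    then show ?case
      using additive_subgroup.a_closed[OF is_additive_subgroup, of "single m (lookup p m)"
          "\<Sum>m\<in>K. single m (lookup p m)"] mem \<open>keys p \<subseteq> M\<close> by auto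
  qed
  then show "p \<in> I" using mpoly_eq_sum[of p] by (metis finite_keys order_refl)
qed

section \<open>Ideals generated by variables: generators, powers, primality\<close>

lemma ideal_heavy: "ideal (mono_span (heavy n F l)) (poly_ring n)"
  by (rule ideal_mono_span) (auto simp: heavy_def weight_add)

text \<open>A positive weight on \<open>F\<close> forces some variable of \<open>F\<close> to divide
  the monomial, and dividing by it lowers the weight by one. This yields the generators of the ideal
  and drives the induction on its powers.\<close>

lemma heavy_Suc_split:
  assumes "m \<in> heavy n F (Suc l)"
  obtains i a where "i \<in> F" "i \<in> {1..n}" "a \<in> heavy n F l" "m = a + single i 1"
proof -
  have "weight F m \<noteq> 0" using assms by (auto simp: heavy_def)
  \<comment> \<open>A sum over an infinite set is 0 by default, so a nonzero weight also shows that
    \<open>F\<close> is finite.\<close>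
  then obtain i where i: "i \<in> F" "lookup m i \<noteq> 0" and F: "finite F"
    by (metis weight_def sum.neutral sum.infinite)
  define a where "a = m - single i 1"
  \<comment> \<open>Subtraction of exponents is truncated; it is exact here because
    \<open>lookup m i\<close> is nonzero.\<close>
  have m: "m = a + single i 1"
    by (rule poly_mapping_eqI) (use i in \<open>auto simp: a_def lookup_add lookup_minus lookup_single when_def\<close>)
  have "i \<in> {1..n}" "a \<in> exps n"
    using assms i m by (auto simp: heavy_def exps_def keys_add_nat in_keys_iff)
  moreover have "l \<le> weight F a"
    using assms i F unfolding heavy_def m by (simp add: weight_add weight_single)
  ultimately show ?thesis using that[of i a] i m by (auto simp: heavy_def)
qed

lemma genideal_var:
  assumes "F \<subseteq> {1..n}"
  shows "genideal (poly_ring n) (var ` F) = (mono_span (heavy n F 1) :: 'k::field mpoly set)"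
proof -
  interpret cring "poly_ring n :: 'k mpoly ring" by (rule cring_poly_ring)
  have "finite F" using assms finite_subset by blast
  then have sub: "var ` F \<subseteq> (mono_span (heavy n F 1) :: 'k mpoly set)"
    using assms by (auto simp: var_def heavy_def weight_single)
  have carr: "var ` F \<subseteq> carrier (poly_ring n :: 'k mpoly ring)"
    using assms by (auto simp: var_def)
  let ?I = "genideal (poly_ring n) (var ` F) :: 'k mpoly set"
  have I: "ideal ?I (poly_ring n)"
    using genideal_ideal carr by blast
  have "mono_span (heavy n F 1) \<subseteq> ?I"
  proof (rule mono_span_subset[OF _ _ I])
    fix m assume "m \<in> heavy n F 1"
    then obtain i a where ia: "i \<in> F" "a \<in> heavy n F 0" "m = a + single i 1"
      using heavy_Suc_split[of m n F 0] by (metis One_nat_def)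
    have "(var i :: 'k mpoly) \<in> ?I"
      using genideal_self[OF carr] ia by auto
    from ideal.I_l_closed[OF I this, of "single a 1"]
    show "single m 1 \<in> ?I"
      using ia by (simp add: var_def mult_single heavy_def)
  qed (auto simp: heavy_def)
  then show ?thesis
    using genideal_minimal[OF ideal_heavy sub] by blast
qed

text \<open>Weights add under multiplication, which bounds the product of the ideals from above.
  Conversely, a monomial of weight at least \<open>Suc l\<close> is a variable of \<open>F\<close>
  times a monomial of weight at least \<open>l\<close>. The zeroth power is the whole ring on both
  sides.\<close>

lemma pow_heavy:
  assumes "F \<subseteq> {1..n}"
  shows "mono_span (heavy n F 1) [^]\<^bsub>ideals_set (poly_ring n)\<^esub> l
    = (mono_span (heavy n F l) :: 'k::field mpoly set)"
proof (induction l)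
  case 0
  have "heavy n F 0 = exps n" by (auto simp: heavy_def)
  then show ?case by (simp add: nat_pow_def ideals_set_def)
next
  case (Suc l)
  interpret cring "poly_ring n :: 'k mpoly ring" by (rule cring_poly_ring)
  let ?P = "ideal_prod (poly_ring n) (mono_span (heavy n F l)) (mono_span (heavy n F 1)) :: 'k mpoly set"
  have fin: "finite F" using assms finite_subset by blast
  have "?P \<subseteq> mono_span (heavy n F (Suc l))"
  proof
    fix p assume "p \<in> ?P"
    then show "p \<in> mono_span (heavy n F (Suc l))"
    proof (induction p rule: ideal_prod.induct)
      case (prod i j)
      then show ?case
        using mono_span_mult[of i "heavy n F l" j "heavy n F 1" "heavy n F (Suc l)"]
        by (simp add: heavy_def weight_add)
    qed (simp add: mono_span_add)
  qed
  moreover have "mono_span (heavy n F (Suc l)) \<subseteq> ?P"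
  proof (rule mono_span_subset)
    show "ideal ?P (poly_ring n)"
      by (intro ideal_prod_is_ideal ideal_heavy)
    fix m assume "m \<in> heavy n F (Suc l)"
    then obtain i a where ia: "i \<in> F" "a \<in> heavy n F l" "m = a + single i 1"
      by (rule heavy_Suc_split)
    have "(single a 1 :: 'k mpoly) \<otimes>\<^bsub>poly_ring n\<^esub> single (single i 1) 1 \<in> ?P"
      using ia assms fin by (intro ideal_prod.prod) (auto simp: heavy_def weight_single)
    then show "single m 1 \<in> ?P" by (simp add: ia mult_single)
  qed (auto simp: heavy_def)
  ultimately have "?P = mono_span (heavy n F (Suc l))" by blast
  then show ?case using Suc by (simp add: nat_pow_def ideals_set_def)
qed

text \<open>Modulo the variables of \<open>F\<close> there remains a polynomial ring in the other
  variables, which is a domain. Instead of the quotient, the proof uses representatives supported on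
  \<open>L\<close>, the exponents that avoid \<open>F\<close>: these are closed under products and
  meet the ideal only in 0.\<close>

lemma primeideal_heavy:
  assumes "F \<subseteq> {1..n}"
  shows "primeideal (mono_span (heavy n F 1)) (poly_ring n :: 'k::field mpoly ring)"
proof (rule primeidealI[OF ideal_heavy cring_poly_ring])
  have fin: "finite F" using assms finite_subset by blast
  let ?P = "mono_span (heavy n F 1) :: 'k mpoly set"
  define L where "L = {m \<in> exps n. weight F m = 0}"
  have heavy_L: "heavy n F 1 = exps n - L"
    by (auto simp: heavy_def L_def)
  have "1 \<notin> ?P"
    by (simp add: mono_span_def heavy_def weight_def)
  moreover have "1 \<in> (mono_span (exps n) :: 'k mpoly set)"
    by (simp flip: single_one)
  ultimately show "carrier (poly_ring n) \<noteq> ?P" by auto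
  \<comment> \<open>Modulo \<open>?P\<close> every polynomial is a polynomial in the variables outside \<open>F\<close>.\<close>
  have split: "\<exists>f0\<in>mono_span L. f - f0 \<in> ?P" if "f \<in> mono_span (exps n)" for f :: "'k mpoly"
  proof
    let ?f0 = "\<Sum>m\<in>keys f \<inter> L. single m (lookup f m)"
    have look: "lookup ?f0 m = (if m \<in> L then lookup f m else 0)" for m
      by (auto simp: lookup_sum lookup_single when_def in_keys_iff)
    show "?f0 \<in> mono_span L"
      by (auto simp: mono_span_def in_keys_iff look split: if_splits)
    have "m \<in> exps n \<and> m \<notin> L" if "m \<in> keys (f - ?f0)" for m
      using that \<open>f \<in> mono_span (exps n)\<close> unfolding in_keys_iff lookup_minus look
      by (auto simp: mono_span_def in_keys_iff split: if_splits)
    then show "f - ?f0 \<in> ?P"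
      unfolding mono_span_def heavy_L by blast
  qed
  interpret P: ideal ?P "poly_ring n" by (rule ideal_heavy)
  fix f g :: "'k mpoly"
  assume f: "f \<in> carrier (poly_ring n)" and g: "g \<in> carrier (poly_ring n)"
    and "f \<otimes>\<^bsub>poly_ring n\<^esub> g \<in> ?P"
  then have fg: "f * g \<in> ?P" by simp
  obtain f0 g0 where f0: "f0 \<in> mono_span L" "f - f0 \<in> ?P" and g0: "g0 \<in> mono_span L" "g - g0 \<in> ?P"
    using split f g by (metis poly_ring_simps(1))
  have LE: "mono_span L \<subseteq> (mono_span (exps n) :: 'k mpoly set)"
    by (rule mono_span_mono) (auto simp: L_def)
  \<comment> \<open>The two products add up to \<open>f * g - f0 * g0\<close>.\<close>
  have "f0 * (g - g0) \<in> ?P" "(f - f0) * g \<in> ?P"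
    using P.I_l_closed[OF g0(2), of f0] P.I_r_closed[OF f0(2), of g] g f0 LE by auto
  then have "f * g + - (f0 * (g - g0) + (f - f0) * g) \<in> ?P"
    by (intro mono_span_add mono_span_uminus fg)
  then have "f0 * g0 \<in> ?P" by (simp add: algebra_simps)
  moreover have "f0 * g0 \<in> mono_span L"
    using mono_span_mult[of f0 L g0 L L] f0 g0 by (simp add: L_def weight_add)
  ultimately have "keys (f0 * g0) = {}"
    unfolding mono_span_def heavy_L by blast
  \<comment> \<open>Polynomials over a field have no zero divisors, so \<open>f0\<close> or
    \<open>g0\<close> is 0 and the corresponding factor lies in \<open>?P\<close>.\<close>
  then have "f0 * g0 = 0" by simp
  then show "f \<in> ?P \<or> g \<in> ?P" using f0 g0 by auto
qed

section \<open>Associated primes, symbolic powers and initial degrees\<close>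

text \<open>If \<open>x\<close> lies in \<open>K\<close> but not in the prime, then \<open>x\<close>
  times a common element of the other ideals lies in all of them, so primality puts that element
  into \<open>I\<close> and the induction applies. The factor \<open>carrier R\<close> makes the
  empty intersection the whole ring, and a prime is proper.\<close>

lemma (in primeideal) Inter_subset_prime:
  assumes "finite \<I>" "\<And>K. K \<in> \<I> \<Longrightarrow> ideal K R" "carrier R \<inter> \<Inter>\<I> \<subseteq> I"
  shows "\<exists>K\<in>\<I>. K \<subseteq> I"
  using assms
proof (induction \<I>)
  case empty
  then show ?case using I_notcarr a_subset by auto
next
  case (insert K \<I>)
  show ?case
  proof (rule ccontr)
    assume *: "\<not> ?thesis"
    then obtain x where x: "x \<in> K" "x \<notin> I" by auto
    interpret K: ideal K R using insert.prems by auto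
    have "carrier R \<inter> \<Inter>\<I> \<subseteq> I"
    proof
      fix y assume y: "y \<in> carrier R \<inter> \<Inter>\<I>"
      have "x \<otimes> y \<in> carrier R \<inter> \<Inter>(insert K \<I>)"
        using x y K.Icarr
        by (auto intro: K.I_r_closed ideal.I_l_closed[OF insert.prems(1)])
      then have "x \<otimes> y \<in> I" using insert.prems(2) by blast
      then show "y \<in> I" using I_prime[of x y] x y K.Icarr by blast
    qed
    then show False using insert.IH insert.prems * by auto
  qed
qed

lemma (in ideal) colon_rcos:
  assumes "x \<in> carrier R"
  shows "{r \<in> carrier R. (I +> r) \<otimes>\<^bsub>R Quot I\<^esub> (I +> x) = \<zero>\<^bsub>R Quot I\<^esub>} = {r \<in> carrier R. r \<otimes> x \<in> I}"
proof -
  have "I +> y = I \<longleftrightarrow> y \<in> I" if "y \<in> carrier R" for y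
    using a_rcos_const a_rcos_self[OF that] by blast
  then show ?thesis
    using assms by (intro Collect_cong conj_cong refl) (simp add: FactRing_def rcoset_mult_add)
qed

lemma associated_primes_colon:
  assumes "ideal J R"
  shows "associated_primes R J =
    {P. primeideal P R \<and> (\<exists>x\<in>carrier R. P = {r \<in> carrier R. r \<otimes>\<^bsub>R\<^esub> x \<in> J})}"
proof -
  interpret ideal J R by (rule assms)
  have "carrier (R Quot J) = (\<lambda>x. J +>\<^bsub>R\<^esub> x) ` carrier R"
    by (auto simp: FactRing_def A_RCOSETS_def')
  then show ?thesis by (auto simp: associated_primes_def colon_rcos)
qed

text \<open>Since each P_F is prime, the colon of their intersection by \<open>x\<close> is the
  intersection of those P_F that do not contain \<open>x\<close>; if this is prime, it is one of
  them. Conversely, incomparability of the sets in \<open>\<B>\<close> makes every component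
  irredundant, hence a colon by a suitable monomial.\<close>

lemma associated_primes_cover:
  assumes fin: "finite \<B>" and ne: "\<B> \<noteq> {}" and sub: "\<And>F. F \<in> \<B> \<Longrightarrow> F \<subseteq> {1..n}"
    and anti: "\<And>F G. F \<in> \<B> \<Longrightarrow> G \<in> \<B> \<Longrightarrow> F \<subseteq> G \<Longrightarrow> F = G"
  shows "associated_primes (poly_ring n) (\<Inter>F\<in>\<B>. mono_span (heavy n F 1))
    = (\<lambda>F. mono_span (heavy n F 1) :: 'k::field mpoly set) ` \<B>"
proof -
  let ?R = "poly_ring n :: 'k mpoly ring"
  let ?P = "\<lambda>F. mono_span (heavy n F 1) :: 'k mpoly set"
  interpret cring ?R by (rule cring_poly_ring)
  note prime = primeideal_heavy[OF sub]
  have J: "ideal (\<Inter>F\<in>\<B>. ?P F) ?R"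
    using i_Intersect[of "?P ` \<B>"] ne ideal_heavy by auto
  have carr: "?P F \<subseteq> carrier ?R" for F
    using mono_span_mono[of "heavy n F 1" "exps n"] by (auto simp: heavy_def)
  have mem: "r * x \<in> ?P F \<longleftrightarrow> x \<in> ?P F \<or> r \<in> ?P F"
    if "F \<in> \<B>" "x \<in> carrier ?R" "r \<in> carrier ?R" for F x r
    using primeideal.I_prime[OF prime, of F r x] ideal.I_l_closed[OF ideal_heavy, of x n F 1 r]
      ideal.I_r_closed[OF ideal_heavy, of r n F 1 x] that by auto
  show ?thesis
  proof (intro equalityI subsetI)
    fix P assume "P \<in> associated_primes ?R (\<Inter>F\<in>\<B>. ?P F)"
    then obtain x where P: "primeideal P ?R" and x: "x \<in> carrier ?R"
      and eq: "P = {r \<in> carrier ?R. r \<otimes>\<^bsub>?R\<^esub> x \<in> (\<Inter>F\<in>\<B>. ?P F)}"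
      unfolding associated_primes_colon[OF J] by blast
    \<comment> \<open>If \<open>x\<close> lies in every component, \<open>?S\<close> is empty and
      the factor \<open>carrier ?R\<close> below gives the whole ring.\<close>
    let ?S = "{F \<in> \<B>. x \<notin> ?P F}"
    have P_eq: "P = carrier ?R \<inter> \<Inter>(?P ` ?S)"
      using x mem unfolding eq by auto
    then obtain F where "F \<in> ?S" "?P F \<subseteq> P"
      using primeideal.Inter_subset_prime[OF P, of "?P ` ?S"] fin ideal_heavy by auto
    moreover have "P \<subseteq> ?P F" using P_eq calculation by blast
    ultimately show "P \<in> ?P ` \<B>" by blast
  next
    fix P assume "P \<in> ?P ` \<B>"
    then obtain F where F: "F \<in> \<B>" "P = ?P F" by auto
    \<comment> \<open>The product of the variables outside \<open>F\<close> lies in every other component, since no other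
      member of \<open>\<B>\<close> is contained in \<open>F\<close>.\<close>
    define m where "m = (\<Sum>i\<in>{1..n} - F. single i (1::nat))"
    have look: "lookup m i = (if i \<in> {1..n} - F then 1 else 0)" for i
      by (simp add: m_def lookup_sum lookup_single when_def)
    have mE: "m \<in> exps n" by (auto simp: exps_def in_keys_iff look split: if_splits)
    let ?x = "single m 1 :: 'k mpoly"
    have x: "?x \<in> carrier ?R" using mE by simp
    have xP: "?x \<in> ?P G \<longleftrightarrow> G \<noteq> F" if G: "G \<in> \<B>" for G
    proof (cases "G = F")
      case True
      then show ?thesis by (auto simp: heavy_def weight_def look)
    next
      case False
      then obtain i where "i \<in> G" "i \<notin> F" using anti[OF G F(1)] by auto
      moreover have "finite G" using sub[OF G] finite_subset by blast
      ultimately have "weight G m \<noteq> 0"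
        using sub[OF G] by (auto simp: weight_def look intro!: bexI[of _ i])
      then show ?thesis using False mE by (auto simp: heavy_def)
    qed
    have "(\<forall>G\<in>\<B>. r * ?x \<in> ?P G) \<longleftrightarrow> r \<in> P" if "r \<in> carrier ?R" for r
      using mem[OF _ x that] xP F by blast
    then have "P = {r \<in> carrier ?R. r \<otimes>\<^bsub>?R\<^esub> ?x \<in> (\<Inter>F\<in>\<B>. ?P F)}"
      using carr[of F] unfolding F(2) poly_ring_simps(3) INT_iff by blast
    moreover have "primeideal P ?R" using prime[OF F(1)] F(2) by simp
    ultimately show "P \<in> associated_primes ?R (\<Inter>F\<in>\<B>. ?P F)"
      unfolding associated_primes_colon[OF J] using x by (intro CollectI conjI bexI)
  qed
qed

text \<open>The integer points of the \<open>l\<close>-fold dilate of the feasible region of the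
  linear program.\<close>

definition cover_exps :: "nat \<Rightarrow> nat set set \<Rightarrow> nat \<Rightarrow> (nat \<Rightarrow>\<^sub>0 nat) set" where
  "cover_exps n \<B> l = {m \<in> exps n. \<forall>F\<in>\<B>. l \<le> weight F m}"

lemma mono_span_cover_exps:
  "mono_span (cover_exps n \<B> l) = mono_span (exps n) \<inter> (\<Inter>F\<in>\<B>. mono_span (heavy n F l))"
  by (auto simp: mono_span_def cover_exps_def heavy_def subset_iff)

lemma symbolic_power_cover:
  assumes "finite \<B>" "\<B> \<noteq> {}" "\<And>F. F \<in> \<B> \<Longrightarrow> F \<subseteq> {1..n}"
    "\<And>F G. F \<in> \<B> \<Longrightarrow> G \<in> \<B> \<Longrightarrow> F \<subseteq> G \<Longrightarrow> F = G"
  shows "symbolic_power (poly_ring n) (\<Inter>F\<in>\<B>. mono_span (heavy n F 1)) l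
    = (mono_span (cover_exps n \<B> l) :: 'k::field mpoly set)"
proof -
  have "(\<Inter>F\<in>\<B>. mono_span (heavy n F 1) [^]\<^bsub>ideals_set (poly_ring n)\<^esub> l)
      = (\<Inter>F\<in>\<B>. mono_span (heavy n F l) :: 'k mpoly set)"
    by (intro INF_cong refl pow_heavy assms(3))
  moreover have "associated_primes (poly_ring n) (\<Inter>F\<in>\<B>. mono_span (heavy n F 1))
      = (\<lambda>F. mono_span (heavy n F 1) :: 'k mpoly set) ` \<B>"
    by (intro associated_primes_cover assms)
  ultimately show ?thesis
    by (simp only: symbolic_power_def mono_span_cover_exps image_image poly_ring_simps)
qed

text \<open>\<open>alpha\<close> ranges over all nonzero elements, measured by their top degree.
  Every monomial occurring in such an element lies in the span and has at most that degree, so a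
  single monomial attains the minimum.\<close>

lemma alpha_mono_span:
  assumes "M \<noteq> {}"
  shows "alpha (mono_span M :: 'k::field mpoly set) = (LEAST d. d \<in> monom_degree ` M)"
    (is "_ = ?d")
  unfolding alpha_def
proof (rule Least_equality)
  have "?d \<in> monom_degree ` M"
    by (rule LeastI_ex) (use assms in blast)
  then obtain m where m: "m \<in> M" "monom_degree m = ?d" by (metis imageE)
  have "(single m 1 :: 'k mpoly) \<noteq> 0"
    by (simp flip: keys_eq_empty)
  moreover have "total_degree (single m 1 :: 'k mpoly) = ?d"
    by (simp add: total_degree_def m(2))
  moreover have "(single m 1 :: 'k mpoly) \<in> mono_span M"
    using m(1) by simp
  ultimately show "\<exists>f\<in>mono_span M :: 'k mpoly set. f \<noteq> 0 \<and> total_degree f = ?d"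
    by blast
next
  fix e assume "\<exists>f\<in>mono_span M :: 'k mpoly set. f \<noteq> 0 \<and> total_degree f = e"
  then obtain f :: "'k mpoly" where f: "keys f \<subseteq> M" "f \<noteq> 0" "total_degree f = e"
    unfolding mono_span_def by blast
  obtain a where a: "a \<in> keys f"
    using f(2) keys_eq_empty by blast
  have "?d \<le> monom_degree a" by (rule Least_le) (use a f in blast)
  also have "\<dots> \<le> total_degree f" using a by (simp add: total_degree_def)
  finally show "?d \<le> e" using f(3) by simp
qed

section \<open>Paving matroids\<close>

lemma finite_bases: "matroid_on E \<Delta> \<Longrightarrow> finite (bases \<Delta>)"
  by (rule finite_subset[of _ "Pow E"]) (auto simp: matroid_on_def bases_def)

lemma bases_subset: "matroid_on E \<Delta> \<Longrightarrow> F \<in> bases \<Delta> \<Longrightarrow> F \<subseteq> E"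
  by (auto simp: matroid_on_def bases_def)

lemma face_finite: "matroid_on E \<Delta> \<Longrightarrow> A \<in> \<Delta> \<Longrightarrow> finite A"
  by (auto simp: matroid_on_def intro: finite_subset)

lemma face_exchange:
  assumes "matroid_on E \<Delta>" "A \<in> \<Delta>" "B \<in> \<Delta>" "card A < card B"
  obtains x where "x \<in> B" "x \<notin> A" "insert x A \<in> \<Delta>"
  using assms unfolding matroid_on_def by blast

lemma face_subset_basis:
  assumes "matroid_on E \<Delta>" "A \<in> \<Delta>"
  obtains F where "F \<in> bases \<Delta>" "A \<subseteq> F"
proof -
  have "finite \<Delta>"
    using assms(1) by (auto simp: matroid_on_def intro: finite_subset[of _ "Pow E"])
  then obtain F where "F \<in> \<Delta>" "A \<subseteq> F" "\<And>G. G \<in> \<Delta> \<Longrightarrow> F \<subseteq> G \<Longrightarrow> F = G"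
    using finite_has_maximal2[of \<Delta> A] assms(2) by auto
  then have "F \<in> bases \<Delta>" unfolding bases_def by blast
  then show ?thesis using that \<open>A \<subseteq> F\<close> by blast
qed

lemma card_face_le_basis:
  assumes "matroid_on E \<Delta>" "A \<in> \<Delta>" "F \<in> bases \<Delta>"
  shows "card A \<le> card F"
proof (rule ccontr)
  assume "\<not> ?thesis"
  moreover have F: "F \<in> \<Delta>" "\<And>G. G \<in> \<Delta> \<Longrightarrow> F \<subseteq> G \<Longrightarrow> F = G"
    using assms(3) unfolding bases_def by blast+
  ultimately obtain x where "x \<notin> F" "insert x F \<in> \<Delta>"
    using face_exchange[OF assms(1) F(1) assms(2)] by (metis not_le)
  then show False using F(2)[of "insert x F"] by blast
qed

text \<open>Any two bases bound each other's size, so the maximum in \<open>matroid_rank\<close> is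
  taken over a single number.\<close>

lemma card_basis:
  assumes "matroid_on E \<Delta>" "F \<in> bases \<Delta>"
  shows "card F = matroid_rank \<Delta>"
proof -
  have "card ` bases \<Delta> = {card F}"
  proof (intro equalityI subsetI)
    fix k assume "k \<in> card ` bases \<Delta>"
    then obtain G where G: "G \<in> bases \<Delta>" "k = card G" by blast
    then have "G \<in> \<Delta>" "F \<in> \<Delta>" using assms(2) by (simp_all add: bases_def)
    then show "k \<in> {card F}"
      using card_face_le_basis[OF assms(1)] assms(2) G by (simp add: le_antisym)
  qed (use assms(2) in simp)
  then show ?thesis by (simp add: matroid_rank_def)
qed

lemma basis_iff:
  assumes "matroid_on E \<Delta>"
  shows "F \<in> bases \<Delta> \<longleftrightarrow> F \<in> \<Delta> \<and> card F = matroid_rank \<Delta>"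
proof (intro iffI conjI)
  assume F: "F \<in> \<Delta> \<and> card F = matroid_rank \<Delta>"
  then obtain G where G: "G \<in> bases \<Delta>" "F \<subseteq> G"
    using face_subset_basis[OF assms] by blast
  then have "finite G" using face_finite[OF assms] by (simp add: bases_def)
  then have "F = G" using card_basis[OF assms G(1)] F G(2) by (simp add: card_subset_eq)
  then show "F \<in> bases \<Delta>" using G by simp
qed (use card_basis[OF assms] in \<open>auto simp: bases_def\<close>)

lemma non_face_contains_circuit:
  assumes "finite D" "D \<subseteq> E" "D \<notin> \<Delta>"
  obtains C where "C \<in> circuits E \<Delta>" "C \<subseteq> D"
proof -
  have "finite {C. C \<subseteq> D \<and> C \<notin> \<Delta>}" using assms(1) by simp
  then obtain C where "C \<subseteq> D" "C \<notin> \<Delta>" "\<And>B. B \<subseteq> D \<Longrightarrow> B \<notin> \<Delta> \<Longrightarrow> B \<subseteq> C \<Longrightarrow> C = B"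
    using finite_has_minimal2[of "{C. C \<subseteq> D \<and> C \<notin> \<Delta>}" D] assms(3) by auto
  then have "C \<in> circuits E \<Delta>" using assms(2) unfolding circuits_def by blast
  then show ?thesis using that \<open>C \<subseteq> D\<close> by blast
qed

text \<open>A dependent set contains a circuit, and a circuit of a paving matroid is too large to
  fit into \<open>D\<close>.\<close>

lemma paving_small_face:
  assumes "matroid_on E \<Delta>" "paving E \<Delta>" "D \<subseteq> E" "card D < matroid_rank \<Delta>"
  shows "D \<in> \<Delta>"
proof (rule ccontr)
  assume "D \<notin> \<Delta>"
  moreover have "finite D" using assms by (auto simp: matroid_on_def intro: finite_subset)
  ultimately obtain C where "C \<in> circuits E \<Delta>" "C \<subseteq> D"
    using non_face_contains_circuit assms(3) by metis
  then show False
    using assms(2,4) card_mono[OF \<open>finite D\<close>, of C] unfolding paving_def by (meson leD le_trans)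
qed

text \<open>In rank 0 the empty set is the only basis, which makes the matroid uniform. This
  justifies dividing by the rank.\<close>

lemma rank_pos_if_not_uniform:
  assumes "matroid_on E \<Delta>" "\<not> uniform E \<Delta>"
  shows "matroid_rank \<Delta> > 0"
proof (rule ccontr)
  assume "\<not> ?thesis"
  then have r: "matroid_rank \<Delta> = 0" by simp
  have "finite E" "{} \<in> \<Delta>" using assms(1) by (auto simp: matroid_on_def)
  have "F \<in> bases \<Delta> \<longleftrightarrow> F = {}" for F
    using basis_iff[OF assms(1), of F] face_finite[OF assms(1), of F] r \<open>{} \<in> \<Delta>\<close>
    by (metis card_eq_0_iff)
  moreover have "F \<subseteq> E \<and> card F = 0 \<longleftrightarrow> F = {}" for F
    using finite_subset[OF _ \<open>finite E\<close>, of F] by auto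
  ultimately have "uniform E \<Delta>" unfolding uniform_def r by blast
  then show False using assms(2) by simp
qed

section \<open>The lower bound of the linear program\<close>

text \<open>Greedy choice: a lightest remaining element is added, and the elements chosen before
  stay below all others.\<close>

lemma subset_of_smallest:
  fixes w :: "'a \<Rightarrow> 'b::linorder"
  assumes "finite E" "k \<le> card E"
  shows "\<exists>A\<subseteq>E. card A = k \<and> (\<forall>i\<in>A. \<forall>j\<in>E - A. w i \<le> w j)"
  using assms(2)
proof (induction k)
  case (Suc k)
  then obtain A where A: "A \<subseteq> E" "card A = k" "\<forall>i\<in>A. \<forall>j\<in>E - A. w i \<le> w j" by auto
  have fin: "finite A" "finite (E - A)" using A(1) assms(1) finite_subset by auto
  have "E - A \<noteq> {}"
    using Suc.prems A card_mono[OF fin(1), of E] by auto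
  then obtain x where x: "x \<in> E - A" "\<forall>j\<in>E - A. w x \<le> w j"
    using fin(2) ex_min_if_finite[of "w ` (E - A)"] by (fastforce simp: not_less)
  have "insert x A \<subseteq> E \<and> card (insert x A) = Suc k \<and> (\<forall>i\<in>insert x A. \<forall>j\<in>E - insert x A. w i \<le> w j)"
    using A x fin(1) by auto
  then show ?case by blast
qed auto

text \<open>\<open>\<alpha>\<close> stands for a lower bound on the size of sets meeting every
  basis. The claim is made for every \<open>t \<ge> 1\<close> below both candidate values; the
  minimum of the two is inserted later.\<close>

lemma paving_weight_bound:
  fixes w :: "'a \<Rightarrow> nat" and \<alpha> l :: nat and t :: real
  assumes M: "matroid_on E \<Delta>" and pav: "paving E \<Delta>" and c: "matroid_rank \<Delta> = c" "c > 0"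
    and w: "\<And>F. F \<in> bases \<Delta> \<Longrightarrow> l \<le> sum w F"
    and \<alpha>: "\<And>T. T \<subseteq> E \<Longrightarrow> (\<And>F. F \<in> bases \<Delta> \<Longrightarrow> F \<inter> T \<noteq> {}) \<Longrightarrow> \<alpha> \<le> card T"
    and t: "1 \<le> t" "t \<le> \<alpha>" "t * c \<le> card E"
  shows "t * l \<le> sum w E"
proof -
  have finE: "finite E" using M by (simp add: matroid_on_def)
  obtain F0 where F0: "F0 \<in> bases \<Delta>"
    using face_subset_basis[OF M, of "{}"] M by (auto simp: matroid_on_def)
  have "c \<le> card E"
    using card_mono[OF finE bases_subset[OF M F0]] card_basis[OF M F0] c by simp
  then obtain A where A: "A \<subseteq> E" "card A = c - 1" "\<forall>i\<in>A. \<forall>j\<in>E - A. w i \<le> w j"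
    using subset_of_smallest[OF finE, of "c - 1" w] by (meson diff_le_self le_trans)
  have finA: "finite A" using A(1) finE finite_subset by blast
  have A\<Delta>: "A \<in> \<Delta>" using paving_small_face[OF M pav A(1)] A(2) c by simp
  define B where "B = {j \<in> E - A. insert j A \<in> \<Delta>}"
  \<comment> \<open>The independent set \<open>A\<close> has one element fewer than
    \<open>F\<close>, so the exchange axiom finds an element of \<open>F\<close> that completes
    \<open>A\<close> to a basis.\<close>
  have exch: "F \<inter> B \<noteq> {}" if F: "F \<in> bases \<Delta>" for F
  proof -
    have "F \<in> \<Delta>" "card A < card F"
      using F card_basis[OF M F] A(2) c by (auto simp: bases_def)
    then obtain x where "x \<in> F" "x \<notin> A" "insert x A \<in> \<Delta>"
      by (rule face_exchange[OF M A\<Delta>])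
    then show ?thesis using bases_subset[OF M F] by (auto simp: B_def)
  qed
  have BE: "B \<subseteq> E" "A \<inter> B = {}" by (auto simp: B_def)
  have finB: "finite B" using BE finE finite_subset by blast
  have \<alpha>B: "\<alpha> \<le> card B" using \<alpha>[OF BE(1)] exch by blast
  have "B \<noteq> {}" using exch[OF F0] by blast
  define m where "m = Min (w ` B)"
  have "m \<in> w ` B" unfolding m_def using finB \<open>B \<noteq> {}\<close> by (intro Min_in) auto
  then obtain j where j: "j \<in> B" "m = w j" by auto
  have m_le: "m \<le> w i" if "i \<in> B" for i
    using that finB by (simp add: m_def)
  \<comment> \<open>\<open>u\<close> is a threshold between the weights on \<open>A\<close> and
    those outside it. The inserted 0 covers the empty \<open>A\<close> in rank 1.\<close>
  define u where "u = Max (insert 0 (w ` A))"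
  have u_ge: "w i \<le> u" if "i \<in> A" for i
    using that finA by (simp add: u_def)
  have u_le: "u \<le> w i" if "i \<in> E - A" for i
    using that finA A(3) by (simp add: u_def)
  define S where "S = sum w A"
  have S_le: "S \<le> (c - 1) * u"
    unfolding S_def A(2)[symmetric] using sum_bounded_above[of A w u] u_ge by simp
  have "insert j A \<in> bases \<Delta>"
    using j(1) A(2) c finA by (simp add: basis_iff[OF M] B_def)
  from w[OF this] have l_le: "l \<le> S + m"
    using j finA by (simp add: S_def B_def)
  define R where "R = E - A - B"
  have cardE: "card E = (c - 1) + card B + card R" and sumE: "sum w E = S + sum w B + sum w R"
  proof -
    have E: "E = (A \<union> B) \<union> R" "finite R" "(A \<union> B) \<inter> R = {}"
      using BE A(1) finE by (auto simp: R_def)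
    show "card E = (c - 1) + card B + card R"
      by (subst E(1)) (use E BE finA finB A(2) in \<open>simp add: card_Un_disjoint\<close>)
    show "sum w E = S + sum w B + sum w R"
      by (subst E(1)) (use E BE finA finB in \<open>simp add: sum.union_disjoint S_def\<close>)
  qed
  have "card B * m \<le> sum w B"
    using sum_bounded_below[of B m w] m_le by simp
  moreover have "card R * u \<le> sum w R"
    using sum_bounded_below[of R u w] u_le by (simp add: R_def)
  ultimately have low: "S + card B * m + card R * u \<le> sum w E" using sumE by simp
  have um: "u \<le> m" using u_le j by (simp add: B_def)
  have "t * l \<le> t * real (S + m)"
    using l_le t(1) by (intro mult_left_mono) auto
  \<comment> \<open>The right side minus the left side is exactly the sum of the three products
    shown to be nonnegative here, once \<open>card E\<close> is replaced by
    \<open>c - 1 + card B + card R\<close>. Each product uses one of the bounds on \<open>t\<close>: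
    by \<open>\<alpha>\<close>, by 1 and by \<open>card E / c\<close>.\<close>
  also have "\<dots> \<le> real (S + card B * m + card R * u)"
  proof -
    have c1: "real (c - 1) = real c - 1" using c by simp
    have "(real (card B) - t) * (real m - real u) \<ge> 0"
      using um t \<alpha>B by (intro mult_nonneg_nonneg) auto
    moreover have "(t - 1) * ((real c - 1) * real u - real S) \<ge> 0"
    proof (intro mult_nonneg_nonneg)
      show "0 \<le> (real c - 1) * real u - real S"
        using S_le by (simp flip: c1 of_nat_mult)
    qed (use t in auto)
    moreover have "(real (card E) - t * c) * u \<ge> 0"
      using t by (intro mult_nonneg_nonneg) auto
    moreover have "real (card E) = real c - 1 + card B + card R"
      using cardE c1 by simp
    ultimately show ?thesis by (simp add: algebra_simps)
  qed
  also have "\<dots> \<le> sum w E" using low of_nat_mono by blast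
  finally show ?thesis by simp
qed

section \<open>The Waldschmidt constant\<close>

definition exponent_of :: "nat \<Rightarrow> (nat \<Rightarrow> nat) \<Rightarrow> nat \<Rightarrow>\<^sub>0 nat" where
  "exponent_of n f = (\<Sum>i=1..n. single i (f i))"

lemma lookup_exponent_of: "lookup (exponent_of n f) i = (if i \<in> {1..n} then f i else 0)"
  by (simp add: exponent_of_def lookup_sum lookup_single when_def)

lemma exponent_of_exps: "exponent_of n f \<in> exps n"
  by (auto simp: exps_def in_keys_iff lookup_exponent_of split: if_splits)

lemma weight_exponent_of: "F \<subseteq> {1..n} \<Longrightarrow> weight F (exponent_of n f) = sum f F"
  unfolding weight_def by (intro sum.cong refl) (auto simp: lookup_exponent_of)

lemma monom_degree_weight: "m \<in> exps n \<Longrightarrow> monom_degree m = weight {1..n} m"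
  unfolding monom_degree_def weight_def exps_def
  by (intro sum.mono_neutral_left) (auto simp: in_keys_iff)

lemma monom_degree_exponent_of: "monom_degree (exponent_of n f) = sum f {1..n}"
  by (simp add: monom_degree_weight[OF exponent_of_exps] weight_exponent_of)

lemma cover_ideal_mono_span:
  assumes "matroid_on {1..n} \<Delta>"
  shows "cover_ideal n \<Delta> = (\<Inter>F\<in>bases \<Delta>. mono_span (heavy n F 1) :: 'k::field mpoly set)"
  unfolding cover_ideal_def using bases_subset[OF assms] by (intro INF_cong refl genideal_var)

lemma exponent_of_cover_exps:
  assumes "\<And>F. F \<in> \<B> \<Longrightarrow> F \<subseteq> {1..n}" "\<And>F. F \<in> \<B> \<Longrightarrow> l \<le> sum f F"
  shows "exponent_of n f \<in> cover_exps n \<B> l"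
  unfolding cover_exps_def using assms exponent_of_exps by (simp add: weight_exponent_of)

text \<open>The optimum of the integer program, free of any reference to the field. For the bases of
  a matroid of positive rank it is the initial degree of the \<open>l\<close>-th symbolic power of
  the cover ideal.\<close>

definition min_cover_degree :: "nat \<Rightarrow> nat set set \<Rightarrow> nat \<Rightarrow> nat" where
  "min_cover_degree n \<B> l = (LEAST d. d \<in> monom_degree ` cover_exps n \<B> l)"

lemma min_cover_degree_le:
  assumes "\<And>F. F \<in> \<B> \<Longrightarrow> F \<subseteq> {1..n}" "\<And>F. F \<in> \<B> \<Longrightarrow> l \<le> sum f F"
  shows "min_cover_degree n \<B> l \<le> sum f {1..n}"
  unfolding min_cover_degree_def monom_degree_exponent_of[symmetric]
  by (intro Least_le imageI exponent_of_cover_exps assms)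

lemma cover_exps_nonempty:
  assumes "\<And>F. F \<in> \<B> \<Longrightarrow> F \<subseteq> {1..n}" "{} \<notin> \<B>"
  shows "cover_exps n \<B> l \<noteq> {}"
proof -
  \<comment> \<open>The constant vector \<open>l\<close> is feasible because every member of
    \<open>\<B>\<close> has at least one element.\<close>
  have "l \<le> (\<Sum>i\<in>F. l)" if F: "F \<in> \<B>" for F
  proof -
    have "card F > 0"
      using F assms finite_subset[OF assms(1)[OF F]] by (auto simp: card_gt_0_iff)
    then show ?thesis by simp
  qed
  then show ?thesis using exponent_of_cover_exps[OF assms(1)] by blast
qed

lemma min_cover_degree_attained:
  assumes "\<And>F. F \<in> \<B> \<Longrightarrow> F \<subseteq> {1..n}" "{} \<notin> \<B>"
  obtains m where "m \<in> cover_exps n \<B> l" "weight {1..n} m = min_cover_degree n \<B> l"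
proof -
  have "min_cover_degree n \<B> l \<in> monom_degree ` cover_exps n \<B> l"
    unfolding min_cover_degree_def
    by (rule LeastI_ex) (use cover_exps_nonempty[OF assms] in blast)
  then obtain m where "m \<in> cover_exps n \<B> l" "monom_degree m = min_cover_degree n \<B> l"
    by (metis imageE)
  then show ?thesis using that monom_degree_weight[of m n] by (simp add: cover_exps_def)
qed

section \<open>Cover ideals of matroids of positive rank\<close>

context
  fixes n c :: nat and \<Delta> :: "nat set set"
  assumes M: "matroid_on {1..n} \<Delta>" and rank: "matroid_rank \<Delta> = c" and c: "c > 0"
begin

lemma bases_sub: "F \<in> bases \<Delta> \<Longrightarrow> F \<subseteq> {1..n}"
  by (rule bases_subset[OF M])

lemma bases_nonempty: "bases \<Delta> \<noteq> {}"
  using face_subset_basis[OF M, of "{}"] M by (auto simp: matroid_on_def)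

lemma empty_not_basis: "{} \<notin> bases \<Delta>"
  using card_basis[OF M, of "{}"] rank c by auto

lemma rank_le: "c \<le> n"
proof -
  obtain F where "F \<in> bases \<Delta>" using bases_nonempty by blast
  then show ?thesis using card_mono[OF _ bases_sub[of F]] card_basis[OF M, of F] rank by simp
qed

lemma alpha_symbolic_power_cover_ideal:
  "alpha (symbolic_power (poly_ring n) (cover_ideal n \<Delta> :: 'k::field mpoly set) l)
    = min_cover_degree n (bases \<Delta>) l"
proof -
  have "symbolic_power (poly_ring n) (cover_ideal n \<Delta> :: 'k mpoly set) l
      = mono_span (cover_exps n (bases \<Delta>) l)"
    unfolding cover_ideal_mono_span[OF M]
  proof (rule symbolic_power_cover[OF finite_bases[OF M] bases_nonempty bases_sub])
    fix F G assume "F \<in> bases \<Delta>" "G \<in> bases \<Delta>" "F \<subseteq> G"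
    then show "F = G" by (simp add: bases_def)
  qed
  then show ?thesis
    using alpha_mono_span[OF cover_exps_nonempty[OF bases_sub empty_not_basis]]
    by (simp add: min_cover_degree_def)
qed

lemma alpha_cover_ideal:
  "alpha (cover_ideal n \<Delta> :: 'k::field mpoly set) = min_cover_degree n (bases \<Delta>) 1"
proof -
  \<comment> \<open>There is at least one basis and every component lies in the ring, so the factor
    \<open>mono_span (exps n)\<close> in \<open>mono_span_cover_exps\<close> is absorbed.\<close>
  have "mono_span (heavy n F 1) \<subseteq> (mono_span (exps n) :: 'k mpoly set)" for F
    by (rule mono_span_mono) (auto simp: heavy_def)
  then have "cover_ideal n \<Delta> = (mono_span (cover_exps n (bases \<Delta>) 1) :: 'k mpoly set)"
    unfolding cover_ideal_mono_span[OF M] mono_span_cover_exps using bases_nonempty by blast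
  then show ?thesis
    using alpha_mono_span[OF cover_exps_nonempty[OF bases_sub empty_not_basis]]
    by (simp add: min_cover_degree_def)
qed

text \<open>Supplies, together with \<open>rank_le\<close>, the condition \<open>1 \<le> t\<close>
  of \<open>paving_weight_bound\<close>.\<close>

lemma min_cover_degree_pos: "min_cover_degree n (bases \<Delta>) 1 \<ge> 1"
proof -
  obtain m where m: "m \<in> cover_exps n (bases \<Delta>) 1"
    "weight {1..n} m = min_cover_degree n (bases \<Delta>) 1"
    using min_cover_degree_attained[OF bases_sub empty_not_basis] by metis
  obtain F where F: "F \<in> bases \<Delta>" using bases_nonempty by blast
  have "1 \<le> weight F m" using m(1) F by (simp add: cover_exps_def)
  also have "\<dots> \<le> weight {1..n} m"
    unfolding weight_def by (rule sum_mono2) (use bases_sub[OF F] in auto)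
  finally show ?thesis using m(2) by simp
qed

text \<open>\<open>paving_weight_bound\<close> is applied to the entries of an optimal exponent for
  \<open>l\<close>, with the initial degree of the cover ideal as \<open>\<alpha>\<close>.\<close>

lemma min_cover_degree_lower:
  fixes t :: real
  assumes "paving {1..n} \<Delta>"
  defines "t \<equiv> min (real (min_cover_degree n (bases \<Delta>) 1)) (real n / real c)"
  shows "t * l \<le> min_cover_degree n (bases \<Delta>) l"
proof -
  obtain m where m: "m \<in> cover_exps n (bases \<Delta>) l"
    "weight {1..n} m = min_cover_degree n (bases \<Delta>) l"
    using min_cover_degree_attained[OF bases_sub empty_not_basis] by metis
  have "t * l \<le> sum (lookup m) {1..n}"
  proof (rule paving_weight_bound[OF M assms(1) rank c])
    show "l \<le> sum (lookup m) F" if "F \<in> bases \<Delta>" for F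
      using m(1) that by (simp add: cover_exps_def weight_def)
    show "min_cover_degree n (bases \<Delta>) 1 \<le> card T"
      if T: "T \<subseteq> {1..n}" "\<And>F. F \<in> bases \<Delta> \<Longrightarrow> F \<inter> T \<noteq> {}" for T
    proof -
      \<comment> \<open>The indicator vector of a set meeting all bases is feasible for
        \<open>l = 1\<close>, and its degree is the size of the set.\<close>
      let ?f = "\<lambda>i. of_bool (i \<in> T) :: nat"
      have sum_f: "sum ?f F = card (F \<inter> T)" if "finite F" for F
        using that by (simp add: sum.If_cases of_bool_def)
      have "1 \<le> sum ?f F" if F: "F \<in> bases \<Delta>" for F
      proof -
        have "finite F" using bases_sub[OF F] finite_subset by blast
        then show ?thesis
          using T(2)[OF F] card_gt_0_iff[of "F \<inter> T"] by (simp add: sum_f Suc_le_eq)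
      qed
      then have "min_cover_degree n (bases \<Delta>) 1 \<le> sum ?f {1..n}"
        by (intro min_cover_degree_le bases_sub)
      also have "\<dots> = card T"
        using T(1) sum_f[of "{1..n}"] by (simp add: Int_absorb1)
      finally show ?thesis .
    qed
    show "1 \<le> t"
      using min_cover_degree_pos rank_le c by (simp add: t_def)
    show "t \<le> min_cover_degree n (bases \<Delta>) 1" by (simp add: t_def)
    have "t \<le> n / c" by (simp add: t_def)
    then show "t * c \<le> card {1..n}" using c by (simp add: pos_le_divide_eq)
  qed
  then show ?thesis unfolding m(2)[symmetric] weight_def .
qed

text \<open>An optimal exponent for the cover ideal, multiplied by \<open>l\<close>, is feasible; in
  terms of ideals, the ordinary power lies in the symbolic power.\<close>

lemma min_cover_degree_le_mult:
  "min_cover_degree n (bases \<Delta>) l \<le> l * min_cover_degree n (bases \<Delta>) 1"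
proof -
  obtain m where m: "m \<in> cover_exps n (bases \<Delta>) 1"
    "weight {1..n} m = min_cover_degree n (bases \<Delta>) 1"
    using min_cover_degree_attained[OF bases_sub empty_not_basis] by metis
  have "min_cover_degree n (bases \<Delta>) l \<le> (\<Sum>i=1..n. l * lookup m i)"
  proof (rule min_cover_degree_le[OF bases_sub])
    fix F assume "F \<in> bases \<Delta>"
    then have "1 \<le> weight F m" using m(1) by (simp add: cover_exps_def)
    then show "l \<le> (\<Sum>i\<in>F. l * lookup m i)"
      by (simp add: weight_def flip: sum_distrib_left)
  qed
  then show ?thesis using m(2) by (simp add: weight_def flip: sum_distrib_left)
qed

text \<open>The constant vector \<open>1 / c\<close>, scaled by \<open>l\<close> and rounded to an
  integer above \<open>l / c\<close>, is feasible because every basis has \<open>c\<close> elements.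
  Rounding costs at most \<open>n\<close> in total degree.\<close>

lemma min_cover_degree_le_const:
  "min_cover_degree n (bases \<Delta>) l \<le> n * (l div c + 1)"
proof -
  have "min_cover_degree n (bases \<Delta>) l \<le> (\<Sum>i=1..n. l div c + 1)"
  proof (rule min_cover_degree_le[OF bases_sub])
    fix F assume "F \<in> bases \<Delta>"
    then have "card F = c" using card_basis[OF M] rank by simp
    moreover have "l \<le> c * (l div c + 1)"
      using c by (metis Suc_eq_plus1 dividend_less_times_div less_imp_le mult_Suc_right add.commute)
    ultimately show "l \<le> (\<Sum>i\<in>F. l div c + 1)" by simp
  qed
  then show ?thesis by simp
qed

text \<open>The sequence is squeezed between the claimed value and that value plus the rounding
  error \<open>n / l\<close>.\<close>

lemma waldschmidt_seq_tendsto: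
  fixes J :: "'k::field mpoly set"
  assumes "paving {1..n} \<Delta>" "J = cover_ideal n \<Delta>"
  shows "waldschmidt_seq n J \<longlonglongrightarrow> min (real (alpha J)) (real n / real c)"
proof -
  let ?a = "min_cover_degree n (bases \<Delta>)"
  define t where "t = min (real (?a 1)) (real n / real c)"
  have seq: "waldschmidt_seq n J = (\<lambda>l. ?a l / l)"
    unfolding waldschmidt_seq_def assms(2) alpha_symbolic_power_cover_ideal ..
  have lower: "t \<le> ?a l / l" if "l > 0" for l
    using min_cover_degree_lower[OF assms(1), of l] that by (simp add: t_def pos_le_divide_eq)
  \<comment> \<open>The bound by the initial degree has no error and the bound by
    \<open>n / c\<close> has error \<open>n / l\<close>, so the minimum plus \<open>n / l\<close> is
    above the sequence in either case.\<close>
  have upper: "?a l / l \<le> t + n / l" if l: "l > 0" for l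
  proof -
    have "real (?a l) \<le> real (l * ?a 1)"
      using min_cover_degree_le_mult of_nat_mono by blast
    then have "?a l / l \<le> ?a 1" using l by (simp add: pos_divide_le_eq mult.commute)
    moreover have "?a l / l \<le> n / c + n / l"
    proof -
      have "real (?a l) \<le> real (n * (l div c + 1))"
        using min_cover_degree_le_const of_nat_mono by blast
      also have "\<dots> \<le> n * (l / c + 1)"
        unfolding of_nat_mult by (intro mult_left_mono) (auto simp: of_nat_div_le_of_nat)
      finally have "?a l / l \<le> n * (l / c + 1) / l" by (rule divide_right_mono) simp
      also have "\<dots> = n / c + n / l"
        using l by (simp add: distrib_left add_divide_distrib)
      finally show ?thesis .
    qed
    moreover have "0 \<le> real n / real l" by simp
    ultimately show ?thesis unfolding t_def by linarith
  qed
  have "(\<lambda>l. ?a l / l) \<longlonglongrightarrow> t"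
  proof (rule tendsto_sandwich)
    \<comment> \<open>At \<open>l = 0\<close> the quotient is a division by 0, so the estimates are
      used from \<open>l = 1\<close> on.\<close>
    show "\<forall>\<^sub>F l in sequentially. t \<le> ?a l / l" "\<forall>\<^sub>F l in sequentially. ?a l / l \<le> t + n / l"
      unfolding eventually_sequentially using lower upper by (meson Suc_le_lessD zero_less_Suc)+
    show "(\<lambda>l. t + n / real l) \<longlonglongrightarrow> t"
      using tendsto_add[OF tendsto_const lim_const_over_n, of t "real n"] by simp
  qed simp
  then show ?thesis
    unfolding seq t_def unfolding assms(2) alpha_cover_ideal .
qed

end

theorem corollary7p8:
  fixes n c :: nat and \<Delta> :: "nat set set" and J :: "'k::field mpoly set"
  assumes "matroid_on {1..n} \<Delta>"
    and "matroid_rank \<Delta> = c"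
    and "paving {1..n} \<Delta>"
    and "\<not> uniform {1..n} \<Delta>"
    and "J = cover_ideal n \<Delta>"
  shows "convergent (waldschmidt_seq n J) \<and>
         waldschmidt n J = min (real (alpha J)) (real n / real c)"
proof -
  have "c > 0" using rank_pos_if_not_uniform[OF assms(1,4)] assms(2) by simp
  from waldschmidt_seq_tendsto[OF assms(1,2) this assms(3,5)] show ?thesis
    unfolding waldschmidt_def by (auto intro: convergentI limI)
qed

end
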